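(* Let $\ell\ge 1$ and let $q$ be a prime power with $q>\ell^\ell$. Then for finite simple graphs $G$ on the vertex set $[\ell]=\{1,\dots,\ell\}$, the polynomial $\chi(\mathcal{A}_G^q,t)$ determines the chromatic polynomial $\chi(G,t)$; that is, if $G$ and $H$ are simple graphs on $[\ell]$ with $\chi(\mathcal{A}_G^q,t)=\chi(\mathcal{A}_H^q,t)$, then $\chi(G,t)=\chi(H,t)$.
   Context: $q$ is a prime power and $\mathbb{F}_q$ the field with $q$ elements. A central arrangement $\mathcal{A}$ is a finite collection of linear hyperplanes in a finite dimensional vector space $V$. Its intersection lattice is $L(\mathcal{A})=\{\bigcap_{H\in\mathcal{B}}H \mid \mathcal{B}\subseteq\mathcal{A}\}$ (the empty intersection being $V$), ordered by reverse inclusion, and its characteristic polynomial is $\chi(\mathcal{A},t)=\sum_{X\in L(\mathcal{A})}\mu(X)t^{\dim X}$, where $\mu(X)=\mu(V,X)$ is the Möbius function of $L(\mathcal{A})$. For a simple graph $G$ on $[\ell]$, the $q$-deformation of the graphical arrangement is the arrangement in $\mathbb{F}_q^\ell$ (with coordinates $x_1,\dots,x_\ell$) $$\mathcal{A}_G^q=\bigcup_{\{i_1,\dots,i_r\}}\Big\{\{a_{i_1}x_{i_1}+\dots+a_{i_r}x_{i_r}=0\}\ \Big|\ (a_{i_1},\dots,a_{i_r})\in\mathbb{F}_q^r\setminus\{0\}\Big\},$$ where $\{i_1,\dots,i_r\}$ runs over all nonempty cliques of $G$ (sets of pairwise adjacent vertices, including single vertices). $\chi(G,t)$ denotes the chromatic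 polynomial of $G$. *)

theory Defs
  imports
    "HOL-Analysis.Cartesian_Space"
    "HOL-Computational_Algebra.Polynomial"
    "HOL-Library.Ramsey"
begin

text \<open>
  A simple graph on the vertex set \<open>UNIV :: 'n set\<close> is given by its edge set, a set of
  two-element sets of vertices. Cliques are those of \<open>HOL-Library.Ramsey\<close>.
\<close>

definition simple_graph :: "'n set set \<Rightarrow> bool" where
  "simple_graph E \<longleftrightarrow> E \<subseteq> nsets UNIV 2"

definition proper_colorings :: "'n set set \<Rightarrow> nat \<Rightarrow> ('n \<Rightarrow> nat) set" where
  "proper_colorings E k = {c. (\<forall>v. c v < k) \<and> (\<forall>u v. {u, v} \<in> E \<longrightarrow> c u \<noteq> c v)}"

text \<open>Existence and uniqueness of this polynomial is lemma \<open>poly_chromatic_poly\<close> below.\<close>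

definition chromatic_poly :: "'n::finite set set \<Rightarrow> int poly" where
  "chromatic_poly E = (THE p. \<forall>k. poly p (int k) = int (card (proper_colorings E k)))"

text \<open>
  Arrangements live in \<open>'a ^ 'n\<close>. The empty intersection \<open>\<Inter>{} = UNIV\<close> is the whole space.
\<close>

definition intersection_lattice :: "'v set set \<Rightarrow> 'v set set" where
  "intersection_lattice A = {\<Inter>B | B. B \<subseteq> A}"

text \<open>
  The Moebius function \<open>\<mu>(X, Y)\<close> of a finite family \<open>L\<close> of sets ordered by reverse inclusion:
  \<open>\<mu>(X, X) = 1\<close>, and the sum of \<open>\<mu>(X, Z)\<close> over \<open>X \<supseteq> Z \<supseteq> Y\<close> in \<open>L\<close> is \<open>0\<close> for \<open>X \<supset> Y\<close>.
  The value is \<open>0\<close> if \<open>Y\<close> is not contained in \<open>X\<close>. Finiteness of \<open>L\<close> is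
  tested only to make the recursion terminate.
\<close>

function moebius :: "'v set set \<Rightarrow> 'v set \<Rightarrow> 'v set \<Rightarrow> int" where
  "moebius L X Y =
     (if X = Y then 1
      else if finite L \<and> Y \<subset> X then - (\<Sum>Z\<in>{Z \<in> L. Y \<subset> Z \<and> Z \<subseteq> X}. moebius L X Z)
      else 0)"
  by pat_completeness auto
termination
proof (relation "Wellfounded.measure (\<lambda>(L, X, Y). card {Z \<in> L. Y \<subset> Z})")
  fix L :: "'v set set" and X Y Z :: "'v set"
  assume "finite L \<and> Y \<subset> X" "Z \<in> {Z \<in> L. Y \<subset> Z \<and> Z \<subseteq> X}"
  then have "{W \<in> L. Z \<subset> W} \<subset> {W \<in> L. Y \<subset> W}" "finite {W \<in> L. Y \<subset> W}"
    by auto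
  then show "((L, X, Z), (L, X, Y)) \<in> Wellfounded.measure (\<lambda>(L, X, Y). card {Z \<in> L. Y \<subset> Z})"
    by (simp add: psubset_card_mono)
qed simp

declare moebius.simps [simp del]

definition arrangement_char_poly :: "('a::field ^ 'n) set set \<Rightarrow> int poly" where
  "arrangement_char_poly A =
     (\<Sum>X\<in>intersection_lattice A. monom (moebius (intersection_lattice A) UNIV X) (vec.dim X))"

text \<open>
  Only the values of the coefficient family \<open>a\<close> on the clique \<open>C\<close> matter; they must not all vanish.
\<close>

definition q_graphical_arrangement :: "'n set set \<Rightarrow> ('a::field ^ 'n) set set" where
  "q_graphical_arrangement E =
     (\<Union>C\<in>{C. C \<noteq> {} \<and> clique C E}. {{x. (\<Sum>i\<in>C. a i * x $ i) = 0} | a. \<exists>i\<in>C. a i \<noteq> 0})"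

lemma card_constant_on_classes:
  fixes R :: "('n::finite \<times> 'n) set"
  shows "\<exists>m. \<forall>k. card {c. (\<forall>v. c v < (k::nat)) \<and> (\<forall>(u, v)\<in>R. c u = c v)} = k ^ m"
proof -
  define S where "S = (R \<union> R\<inverse>)\<^sup>*"
  have S: "equiv UNIV S"
    unfolding S_def
    by (intro equivI refl_rtrancl sym_rtrancl trans_rtrancl) (auto simp: sym_def)
  have "card {c. (\<forall>v. c v < k) \<and> (\<forall>(u, v)\<in>R. c u = c v)} = k ^ card (UNIV // S)" for k :: nat
  proof -
    let ?F = "{c. (\<forall>v. c v < k) \<and> (\<forall>(u, v)\<in>R. c u = c v)}"
    let ?P = "PiE (UNIV // S) (\<lambda>_. {..<k})"
    have const: "c u = c v" if c: "c \<in> ?F" and uv: "(u, v) \<in> S" for c u v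
      using uv unfolding S_def by (induction rule: rtrancl_induct) (use c in auto)
    have mem: "v \<in> S `` {v}" for v
      using S by (rule equiv_class_self) simp
    have "bij_betw (\<lambda>g v. g (S `` {v})) ?P ?F"
    proof (rule bij_betwI[where g = "\<lambda>c. restrict (\<lambda>X. c (SOME v. v \<in> X)) (UNIV // S)"])
      show "(\<lambda>g v. g (S `` {v})) \<in> ?P \<rightarrow> ?F"
      proof (intro Pi_I CollectI conjI allI ballI, goal_cases)
        case (1 g v)
        then show ?case by (auto simp: PiE_def Pi_def quotientI)
      next
        case (2 g p)
        then have "p \<in> S" unfolding S_def by auto
        then show ?case
          using equiv_class_eq[OF S] by (cases p) auto
      qed
      show "(\<lambda>c. restrict (\<lambda>X. c (SOME v. v \<in> X)) (UNIV // S)) \<in> ?F \<rightarrow> ?P"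
        by auto
      show "restrict (\<lambda>X. g (S `` {SOME v. v \<in> X})) (UNIV // S) = g" if g: "g \<in> ?P" for g
      proof (rule ext)
        fix X
        show "restrict (\<lambda>X. g (S `` {SOME v. v \<in> X})) (UNIV // S) X = g X"
        proof (cases "X \<in> UNIV // S")
          case True
          then obtain v where X: "X = S `` {v}" by (auto elim: quotientE)
          have "(SOME v. v \<in> X) \<in> X" using mem[of v] X by (metis someI)
          then have "S `` {SOME v. v \<in> X} = X"
            using equiv_class_eq[OF S] X by blast
          then show ?thesis using True by simp
        next
          case False
          then show ?thesis using g by (auto simp: PiE_def extensional_def)
        qed
      qed
      show "(\<lambda>v. restrict (\<lambda>X. c (SOME v. v \<in> X)) (UNIV // S) (S `` {v})) = c"
        if c: "c \<in> ?F" for c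
      proof (rule ext)
        fix v
        have "(SOME u. u \<in> S `` {v}) \<in> S `` {v}" using mem[of v] by (metis someI)
        then show "restrict (\<lambda>X. c (SOME v. v \<in> X)) (UNIV // S) (S `` {v}) = c v"
          using const[OF c, of v "SOME u. u \<in> S `` {v}"] by (simp add: quotientI)
      qed
    qed
    then have "card ?P = card ?F" by (rule bij_betw_same_card)
    then show ?thesis by (simp add: card_PiE)
  qed
  then show ?thesis by blast
qed

lemma ex_coloring_poly:
  fixes D R :: "('n::finite \<times> 'n) set"
  shows "\<exists>p::int poly. \<forall>k. poly p (int k) =
           int (card {c. (\<forall>v. c v < k) \<and> (\<forall>(u, v)\<in>R. c u = c v) \<and> (\<forall>(u, v)\<in>D. c u \<noteq> c v)})"
proof -
  have "finite D" by simp
  then show ?thesis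
  proof (induction D arbitrary: R)
    case empty
    obtain m where m: "\<And>k. card {c. (\<forall>v. c v < (k::nat)) \<and> (\<forall>(u, v)\<in>R. c u = c v)} = k ^ m"
      using card_constant_on_classes[of R] by blast
    show ?case by (rule exI[of _ "monom 1 m"]) (simp add: m poly_monom)
  next
    case (insert d D)
    let ?N = "\<lambda>R D k. {c. (\<forall>v. c v < (k::nat)) \<and> (\<forall>(u, v)\<in>R. c u = c v) \<and> (\<forall>(u, v)\<in>D. c u \<noteq> c v)}"
    obtain p where p: "\<And>k. poly p (int k) = int (card (?N R D k))"
      using insert.IH[of R] by blast
    obtain r where r: "\<And>k. poly r (int k) = int (card (?N (insert d R) D k))"
      using insert.IH[of "insert d R"] by blast
    have "int (card (?N R (insert d D) k)) = poly (p - r) (int k)" for k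
    proof -
      have fin: "finite (?N R D k)" for R D :: "('n \<times> 'n) set"
        by (rule finite_subset[of _ "PiE UNIV (\<lambda>_. {..<k})"]) (auto intro!: finite_PiE)
      have split: "?N R D k = ?N R (insert d D) k \<union> ?N (insert d R) D k"
        by (cases d) auto
      have disj: "?N R (insert d D) k \<inter> ?N (insert d R) D k = {}"
        by (cases d) auto
      have "card (?N R D k) = card (?N R (insert d D) k) + card (?N (insert d R) D k)"
        using card_Un_disjoint[OF fin fin disj] split by simp
      then show ?thesis by (simp add: p r)
    qed
    then show ?case by metis
  qed
qed

lemma poly_chromatic_poly:
  "poly (chromatic_poly E) (int k) = int (card (proper_colorings E k))"
proof -
  let ?Q = "\<lambda>p. \<forall>k. poly p (int k) = int (card (proper_colorings E k))"
  have "{c. (\<forall>v. c v < k) \<and> (\<forall>(u, v)\<in>{}. c u = c v) \<and> (\<forall>(u, v)\<in>{(u, v). {u, v} \<in> E}. c u \<noteq> c v)}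
          = proper_colorings E k" for k
    by (auto simp: proper_colorings_def)
  then obtain p where p: "?Q p"
    using ex_coloring_poly[of "{}" "{(u, v). {u, v} \<in> E}"] by auto
  have "p' = p" if "?Q p'" for p'
  proof (rule ccontr)
    assume "p' \<noteq> p"
    then have "finite {x. poly (p' - p) x = 0}" by (intro poly_roots_finite) simp
    moreover have "range int \<subseteq> {x. poly (p' - p) x = 0}" using that p by auto
    ultimately have "finite (range int)" by (rule rev_finite_subset)
    then show False using finite_imageD[of int UNIV] by simp
  qed
  then have "?Q (chromatic_poly E)"
    unfolding chromatic_poly_def using p by (rule theI[of ?Q, rotated])
  then show ?thesis by blast
qed

end

theory Submission
  imports Defs
begin

text \<open>
  The idea is to recover the number of proper colourings with \<open>m\<close> colours modulo \<open>q - 1\<close> from the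
  value of \<open>\<chi>(A, t)\<close> at \<open>t = q ^ m\<close>.

  By Moebius inversion over the intersection lattice, \<open>\<chi>(A, q ^ m)\<close> is the number of \<open>m\<close>-tuples
  of points such that no hyperplane of \<open>A\<close> contains the whole tuple
  (\<open>poly_arrangement_char_poly\<close>). For the \<open>q\<close>-deformation of a graphical arrangement, write such a
  tuple as the rows of a matrix with \<open>m\<close> rows and one column per vertex; the condition then says
  that the columns at the vertices of any clique are linearly independent.

  Such matrices can be multiplied by nonzero scalars in each column and in each row. Every column
  is nonzero, so the column scalings, a group of order \<open>(q - 1) ^ \<ell>\<close>, act freely. If some column has
  two nonzero entries, then scaling the row of one of them is a further independent symmetry, so
  that matrices of this kind contribute a multiple of \<open>(q - 1) ^ (\<ell> + 1)\<close>
  (\<open>dvd_card_shared_at\<close>). In the remaining matrices every column is a multiple of a unit vector;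
  the positions of these unit vectors form a proper colouring, and each colouring arises
  \<open>(q - 1) ^ \<ell>\<close> times (\<open>card_monomial_matrices\<close>). Dividing by \<open>(q - 1) ^ \<ell>\<close> gives the number of proper
  colourings modulo \<open>q - 1\<close>.

  For \<open>m \<le> \<ell>\<close> two such numbers differ by less than \<open>\<ell> ^ \<ell> \<le> q - 1\<close>, hence they are
  equal once they are congruent. Finally, a colouring of \<open>\<ell>\<close> vertices uses at most \<open>\<ell>\<close> colours, so
  that the numbers of colourings with at most \<open>\<ell>\<close> colours determine all of them
  (\<open>card_proper_colorings_determined\<close>).
\<close>

section \<open>The characteristic polynomial counts tuples avoiding the arrangement\<close>

lemma card_subspace:
  fixes X :: "('a::{field,finite} ^ 'n::finite) set"
  assumes "vec.subspace X"
  shows "card X = CARD('a) ^ vec.dim X"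
proof -
  obtain B where B: "B \<subseteq> X" "vec.independent B" "X \<subseteq> vec.span B" "card B = vec.dim X"
    using vec.basis_exists by blast
  have X: "X = vec.span B"
    using B(1,3) assms vec.span_minimal by blast
  let ?f = "\<lambda>g. \<Sum>b\<in>B. g b *s b"
  have "inj_on ?f (B \<rightarrow>\<^sub>E UNIV)"
  proof (rule inj_onI)
    fix g h assume g: "g \<in> B \<rightarrow>\<^sub>E UNIV" and h: "h \<in> B \<rightarrow>\<^sub>E UNIV" and "?f g = ?f h"
    then have "(\<Sum>b\<in>B. (g b - h b) *s b) = 0"
      by (simp add: vec.scale_left_diff_distrib sum_subtractf)
    then have "g b - h b = 0" if "b \<in> B" for b
      using vec.independentD[OF B(2), of B "\<lambda>b. g b - h b" b] that by auto
    then show "g = h"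
      by (intro PiE_ext[OF g h]) auto
  qed
  moreover have "?f ` (B \<rightarrow>\<^sub>E UNIV) = X"
  proof -
    have "?f g \<in> ?f ` (B \<rightarrow>\<^sub>E UNIV)" for g
      by (rule image_eqI[of _ _ "restrict g B"]) auto
    then have "?f ` (B \<rightarrow>\<^sub>E UNIV) = range ?f"
      by blast
    then show ?thesis
      unfolding X by (subst vec.span_finite) auto
  qed
  ultimately have "bij_betw ?f (B \<rightarrow>\<^sub>E UNIV) X"
    by (rule bij_betw_imageI)
  then have "card X = card (B \<rightarrow>\<^sub>E (UNIV :: 'a set))"
    by (simp add: bij_betw_same_card)
  then show ?thesis
    by (simp add: card_PiE B(4))
qed

lemma sum_moebius_upper:
  assumes "finite L" "U \<in> L" "Y \<in> L" "Y \<subseteq> U" "\<And>Z. Z \<in> L \<Longrightarrow> Z \<subseteq> U"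
  shows "(\<Sum>Z\<in>{Z \<in> L. Y \<subseteq> Z}. moebius L U Z) = (if Y = U then 1 else 0)"
proof (cases "Y = U")
  case True
  then have "{Z \<in> L. Y \<subseteq> Z} = {U}"
    using assms by auto
  then show ?thesis
    using True by (simp add: moebius.simps)
next
  case False
  have split: "{Z \<in> L. Y \<subseteq> Z} = insert Y {Z \<in> L. Y \<subset> Z \<and> Z \<subseteq> U}"
    using assms by auto
  have "moebius L U Y = - (\<Sum>Z\<in>{Z \<in> L. Y \<subset> Z \<and> Z \<subseteq> U}. moebius L U Z)"
    using False assms by (subst moebius.simps) auto
  then show ?thesis
    using False assms(1) by (simp add: split)
qed

lemma Inter_intersection_lattice:
  assumes "B \<subseteq> intersection_lattice A"
  shows "\<Inter>B \<in> intersection_lattice A"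
proof -
  let ?C = "{H \<in> A. \<exists>X\<in>B. X \<subseteq> H}"
  have "\<Inter>?C \<subseteq> X" if "X \<in> B" for X
  proof -
    obtain C where "C \<subseteq> A" "X = \<Inter>C"
      using assms \<open>X \<in> B\<close> unfolding intersection_lattice_def by blast
    then have "C \<subseteq> ?C"
      using \<open>X \<in> B\<close> by auto
    then show ?thesis
      unfolding \<open>X = \<Inter>C\<close> by (rule Inter_anti_mono)
  qed
  then have "\<Inter>B = \<Inter>?C"
    by auto
  then show ?thesis
    unfolding intersection_lattice_def by blast
qed

definition avoiding_tuples :: "'v set set \<Rightarrow> nat \<Rightarrow> (nat \<Rightarrow> 'v) set" where
  "avoiding_tuples A m = {M \<in> {..<m} \<rightarrow>\<^sub>E UNIV. \<forall>X\<in>A. \<exists>r<m. M r \<notin> X}"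

text \<open>
  This is the finite-field method in the form of Crapo and Rota. Expanding \<open>(q ^ m) ^ dim X\<close> as
  the number of \<open>m\<close>-tuples in \<open>X\<close> and exchanging sums, a tuple is counted with weight
  \<open>\<Sum>\<mu>(V, X)\<close> over the flats \<open>X\<close> containing the smallest flat around the tuple. This weight is \<open>0\<close>
  unless that smallest flat is the whole space.
\<close>

lemma poly_arrangement_char_poly:
  fixes A :: "('a::{field,finite} ^ 'n::finite) set set"
  assumes subsp: "\<And>X. X \<in> A \<Longrightarrow> vec.subspace X" and proper: "UNIV \<notin> A"
  shows "poly (arrangement_char_poly A) (int (CARD('a) ^ m)) = int (card (avoiding_tuples A m))"
proof -
  define L where "L = intersection_lattice A"
  define W where "W = {..<m} \<rightarrow>\<^sub>E (UNIV :: ('a ^ 'n) set)"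
  define Inside where "Inside = (\<lambda>M X. \<forall>r<m. M r \<in> (X :: ('a ^ 'n) set))"
  have fin: "finite L" "finite W"
    by (auto simp: W_def intro!: finite_PiE)
  have UL: "UNIV \<in> L"
    unfolding L_def intersection_lattice_def by (rule CollectI) (rule exI[of _ "{}"], simp)
  have AL: "A \<subseteq> L"
    unfolding L_def intersection_lattice_def by (auto intro: exI[of _ "{_}"])
  have subL: "vec.subspace X" if "X \<in> L" for X
  proof -
    obtain B where "B \<subseteq> A" "X = \<Inter>B"
      using \<open>X \<in> L\<close> unfolding L_def intersection_lattice_def by blast
    then show ?thesis
      using subsp by (auto intro!: vec.subspace_Inter)
  qed
  have tuples: "int (CARD('a) ^ m) ^ vec.dim X = int (card {M \<in> W. Inside M X})" if "X \<in> L" for X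
  proof -
    have "{M \<in> W. Inside M X} = {..<m} \<rightarrow>\<^sub>E X"
      by (auto simp: W_def Inside_def PiE_def Pi_def)
    then show ?thesis
      using card_subspace[OF subL[OF that]]
      by (simp add: card_PiE mult.commute flip: power_mult)
  qed
  have weight: "(\<Sum>X\<in>{X \<in> L. Inside M X}. moebius L UNIV X)
                  = (if M \<in> avoiding_tuples A m then 1 else 0)" if "M \<in> W" for M
  proof -
    define Y where "Y = \<Inter>{X \<in> L. Inside M X}"
    have YL: "Y \<in> L"
      unfolding Y_def L_def by (rule Inter_intersection_lattice) auto
    have "Inside M Y"
      by (auto simp: Y_def Inside_def)
    then have "{X \<in> L. Inside M X} = {X \<in> L. Y \<subseteq> X}"
      by (auto simp: Y_def Inside_def)
    moreover have "Y = UNIV \<longleftrightarrow> M \<in> avoiding_tuples A m"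
    proof
      assume "Y = UNIV"
      then have "X = UNIV" if "X \<in> A" "Inside M X" for X
        using that AL unfolding Y_def by auto
      then show "M \<in> avoiding_tuples A m"
        using \<open>M \<in> W\<close> proper by (auto simp: avoiding_tuples_def W_def Inside_def)
    next
      assume avoid: "M \<in> avoiding_tuples A m"
      obtain B where B: "B \<subseteq> A" "Y = \<Inter>B"
        using YL unfolding L_def intersection_lattice_def by blast
      have "X \<notin> B" for X
      proof
        assume "X \<in> B"
        then have "X \<in> A" "Y \<subseteq> X"
          using B by blast+
        then show False
          using \<open>Inside M Y\<close> avoid unfolding avoiding_tuples_def Inside_def by blast
      qed
      then have "B = {}"
        by blast
      then show "Y = UNIV"
        using B by simp
    qed
    ultimately show ?thesis
      using sum_moebius_upper[OF fin(1) UL YL] by simp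
  qed
  have "poly (arrangement_char_poly A) (int (CARD('a) ^ m))
          = (\<Sum>X\<in>L. moebius L UNIV X * int (card {M \<in> W. Inside M X}))"
    using tuples by (simp add: arrangement_char_poly_def poly_sum poly_monom flip: L_def)
  also have "\<dots> = (\<Sum>X\<in>L. \<Sum>M\<in>W. if Inside M X then moebius L UNIV X else 0)"
    using fin by (simp add: sum.If_cases Int_def mult.commute)
  also have "\<dots> = (\<Sum>M\<in>W. \<Sum>X\<in>L. if Inside M X then moebius L UNIV X else 0)"
    by (rule sum.swap)
  also have "\<dots> = (\<Sum>M\<in>W. if M \<in> avoiding_tuples A m then 1 else 0)"
    by (rule sum.cong) (use fin weight in \<open>simp_all add: sum.If_cases Int_def\<close>)
  also have "\<dots> = int (card (avoiding_tuples A m))"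
  proof -
    have "W \<inter> avoiding_tuples A m = avoiding_tuples A m"
      by (auto simp: W_def avoiding_tuples_def)
    then show ?thesis
      using fin(2) by (simp add: sum.If_cases)
  qed
  finally show ?thesis .
qed

section \<open>Matrices with independent columns on cliques\<close>

text \<open>
  Row \<open>r\<close> of a matrix is \<open>M r\<close>, with column index in the vertex set. The condition says that the
  columns at the vertices of a clique satisfy no nontrivial linear relation.
\<close>

definition clique_matrices :: "'n set set \<Rightarrow> nat \<Rightarrow> (nat \<Rightarrow> 'a::field ^ 'n::finite) set" where
  "clique_matrices E m = {M \<in> {..<m} \<rightarrow>\<^sub>E UNIV. \<forall>C a. clique C E \<longrightarrow> (\<exists>i\<in>C. a i \<noteq> 0) \<longrightarrow>
     (\<exists>r<m. (\<Sum>i\<in>C. a i * M r $ i) \<noteq> 0)}"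

lemma clique_matricesE:
  assumes "M \<in> clique_matrices E m" "clique C E" "\<exists>i\<in>C. a i \<noteq> 0"
  obtains r where "r < m" "(\<Sum>i\<in>C. a i * M r $ i) \<noteq> 0"
proof -
  have "\<forall>C a. clique C E \<longrightarrow> (\<exists>i\<in>C. a i \<noteq> 0) \<longrightarrow> (\<exists>r<m. (\<Sum>i\<in>C. a i * M r $ i) \<noteq> 0)"
    using assms(1) by (simp add: clique_matrices_def)
  then have "\<exists>r<m. (\<Sum>i\<in>C. a i * M r $ i) \<noteq> 0"
    using assms(2,3) by (elim allE[of _ C] allE[of _ a]) simp
  then show thesis
    using that by blast
qed

lemma avoiding_tuples_q_graphical_arrangement:
  "avoiding_tuples (q_graphical_arrangement E) m
     = (clique_matrices E m :: (nat \<Rightarrow> 'a::field ^ 'n::finite) set)"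
proof -
  have "(\<forall>X\<in>q_graphical_arrangement E. P X) \<longleftrightarrow>
      (\<forall>C a. clique C E \<longrightarrow> (\<exists>i\<in>C. a i \<noteq> 0) \<longrightarrow> P {x. (\<Sum>i\<in>C. a i * x $ i) = 0})"
    for P :: "('a ^ 'n) set \<Rightarrow> bool"
    unfolding q_graphical_arrangement_def by blast
  then show ?thesis
    by (simp add: avoiding_tuples_def clique_matrices_def)
qed

lemma poly_char_poly_q_graphical_arrangement:
  fixes E :: "'n::finite set set"
  shows "poly (arrangement_char_poly (q_graphical_arrangement E :: ('a::{field,finite} ^ 'n) set set))
           (int (CARD('a) ^ m))
         = int (card (clique_matrices E m :: (nat \<Rightarrow> 'a ^ 'n) set))"
proof -
  have "vec.subspace X" if "X \<in> (q_graphical_arrangement E :: ('a ^ 'n) set set)" for X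
    using that unfolding q_graphical_arrangement_def
    by (auto simp: vec.subspace_def algebra_simps sum.distrib simp flip: sum_distrib_left)
  moreover have "UNIV \<notin> (q_graphical_arrangement E :: ('a ^ 'n) set set)"
  proof
    assume "UNIV \<in> (q_graphical_arrangement E :: ('a ^ 'n) set set)"
    then obtain C and a :: "'n \<Rightarrow> 'a" and j
      where all: "\<And>x. (\<Sum>i\<in>C. a i * x $ i) = 0" and j: "j \<in> C" "a j \<noteq> 0"
      unfolding q_graphical_arrangement_def by blast
    have "(\<Sum>i\<in>C. a i * axis j 1 $ i) = (\<Sum>i\<in>C. if i = j then a i else 0)"
      by (intro sum.cong) (auto simp: axis_def)
    then show False
      using all[of "axis j 1"] j by simp
  qed
  ultimately show ?thesis
    using poly_arrangement_char_poly[of "q_graphical_arrangement E :: ('a ^ 'n) set set" m]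
    unfolding avoiding_tuples_q_graphical_arrangement by blast
qed

lemma clique_matrices_column_nonzero:
  assumes "M \<in> clique_matrices E m"
  shows "\<exists>r<m. M r $ v \<noteq> 0"
proof -
  have "clique {v} E"
    by (simp add: clique_def)
  then obtain r where "r < m" "(\<Sum>i\<in>{v}. 1 * M r $ i) \<noteq> 0"
    using clique_matricesE[OF assms, of "{v}" "\<lambda>_. 1"] by auto
  then show ?thesis
    by auto
qed

section \<open>Scaling columns and one row\<close>

text \<open>
  The group is left abstract: it enters only through the family \<open>act\<close> of its operations, indexed
  by \<open>U\<close>. Freeness appears as injectivity of the orbit maps.
\<close>

lemma card_dvd_card_if_free_action:
  assumes "finite X"
    and act: "\<And>g x. g \<in> U \<Longrightarrow> x \<in> X \<Longrightarrow> act g x \<in> X"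
    and one: "e \<in> U" "\<And>x. x \<in> X \<Longrightarrow> act e x = x"
    and mult: "\<And>g h. g \<in> U \<Longrightarrow> h \<in> U \<Longrightarrow> \<exists>k\<in>U. \<forall>x\<in>X. act g (act h x) = act k x"
    and inv: "\<And>g. g \<in> U \<Longrightarrow> \<exists>h\<in>U. \<forall>x\<in>X. act h (act g x) = x"
    and free: "\<And>x. x \<in> X \<Longrightarrow> inj_on (\<lambda>g. act g x) U"
  shows "card U dvd card X"
proof -
  define R where "R = {(x, act g x) | x g. x \<in> X \<and> g \<in> U}"
  have R: "(x, y) \<in> R \<longleftrightarrow> x \<in> X \<and> (\<exists>g\<in>U. y = act g x)" for x y
    by (auto simp: R_def)
  have sub: "R \<subseteq> X \<times> X"
    using act by (auto simp: R_def)
  have "equiv X R"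
  proof (intro equivI sub)
    show "refl_on X R"
      using one by (auto simp: refl_on_def R) metis
    show "sym R"
      using inv act by (auto simp: sym_def R) metis
    show "trans R"
      using mult by (auto simp: trans_def R) metis
  qed
  then show ?thesis
  proof (rule equiv_imp_dvd_card[OF \<open>finite X\<close>])
    fix K assume "K \<in> X // R"
    then obtain x where x: "x \<in> X" "K = R `` {x}"
      by (auto elim: quotientE)
    then have "K = (\<lambda>g. act g x) ` U"
      by (auto simp: R)
    then show "card U dvd card K"
      using card_image[OF free[OF x(1)]] by simp
  qed
qed

definition scale_matrix ::
    "nat \<Rightarrow> nat \<Rightarrow> ('n \<Rightarrow> 'a) \<times> 'a \<Rightarrow> (nat \<Rightarrow> 'a ^ 'n) \<Rightarrow> (nat \<Rightarrow> 'a::field ^ 'n::finite)" where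
  "scale_matrix m s g M =
     (\<lambda>r\<in>{..<m}. \<chi> v. fst g v * (if r = s then snd g else 1) * M r $ v)"

definition nonzero_scalings :: "(('n \<Rightarrow> 'a::zero) \<times> 'a) set" where
  "nonzero_scalings = {u. \<forall>v. u v \<noteq> 0} \<times> {t. t \<noteq> 0}"

lemma card_nonzero_functions:
  "card {u :: 'n::finite \<Rightarrow> 'a::{zero,finite}. \<forall>v. u v \<noteq> 0} = (CARD('a) - 1) ^ CARD('n)"
proof -
  have "{u :: 'n \<Rightarrow> 'a. \<forall>v. u v \<noteq> 0} = UNIV \<rightarrow>\<^sub>E (UNIV - {0})"
    by (auto simp: PiE_def Pi_def)
  then show ?thesis
    by (simp add: card_PiE card_Diff_singleton)
qed

lemma card_nonzero_scalings:
  "card (nonzero_scalings :: (('n::finite \<Rightarrow> 'a::{zero,finite}) \<times> 'a) set)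
     = (CARD('a) - 1) ^ (CARD('n) + 1)"
proof -
  have "{t :: 'a. t \<noteq> 0} = UNIV - {0}"
    by auto
  then have "card {t :: 'a. t \<noteq> 0} = CARD('a) - 1"
    by (simp add: card_Diff_singleton)
  then show ?thesis
    by (simp add: nonzero_scalings_def card_cartesian_product card_nonzero_functions mult.commute)
qed

lemma scale_matrix_eq_0_iff:
  assumes "g \<in> nonzero_scalings" "r < m"
  shows "scale_matrix m s g M r $ v = 0 \<longleftrightarrow> M r $ v = 0"
  using assms by (auto simp: scale_matrix_def nonzero_scalings_def)

lemma scale_matrix_mem_clique_matrices:
  fixes M :: "nat \<Rightarrow> 'a::field ^ 'n::finite"
  assumes g: "g \<in> nonzero_scalings" and M: "M \<in> clique_matrices E m"
  shows "scale_matrix m s g M \<in> clique_matrices E m"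
proof -
  have "\<exists>r<m. (\<Sum>i\<in>C. a i * scale_matrix m s g M r $ i) \<noteq> 0"
    if C: "clique C E" and a: "\<exists>i\<in>C. a i \<noteq> 0" for C and a :: "'n \<Rightarrow> 'a"
  proof -
    have "\<exists>i\<in>C. a i * fst g i \<noteq> 0"
      using a g by (auto simp: nonzero_scalings_def)
    then obtain r where r: "r < m" "(\<Sum>i\<in>C. (a i * fst g i) * M r $ i) \<noteq> 0"
      by (rule clique_matricesE[OF M C])
    have "(\<Sum>i\<in>C. a i * scale_matrix m s g M r $ i)
        = (if r = s then snd g else 1) * (\<Sum>i\<in>C. (a i * fst g i) * M r $ i)"
      using r(1) by (simp add: scale_matrix_def sum_distrib_left mult_ac)
    then have "(\<Sum>i\<in>C. a i * scale_matrix m s g M r $ i) \<noteq> 0"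
      using r g by (auto simp: nonzero_scalings_def)
    then show ?thesis
      using r(1) by blast
  qed
  then show ?thesis
    by (simp add: clique_matrices_def) (simp add: scale_matrix_def)
qed

definition shared_row :: "nat \<Rightarrow> (nat \<Rightarrow> 'a::zero ^ 'n) \<Rightarrow> nat \<Rightarrow> bool" where
  "shared_row m M s \<longleftrightarrow> s < m \<and> (\<exists>v. M s $ v \<noteq> 0 \<and> (\<exists>r<m. r \<noteq> s \<and> M r $ v \<noteq> 0))"

text \<open>
  Taking the least shared row makes the choice of the extra row to be scaled depend on the support
  of the matrix only, so that it is invariant under scaling.
\<close>

definition shared_at :: "'n set set \<Rightarrow> nat \<Rightarrow> nat \<Rightarrow> (nat \<Rightarrow> 'a::field ^ 'n::finite) set" where
  "shared_at E m s =
     {M \<in> clique_matrices E m. shared_row m M s \<and> (\<forall>r<s. \<not> shared_row m M r)}"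

text \<open>
  Freeness is the point: in the column witnessing that row \<open>s\<close> is shared, the entry outside row
  \<open>s\<close> recovers the column factor, then the entry in row \<open>s\<close> recovers the row factor, and then any
  nonzero entry of another column recovers the factor of that column.
\<close>

lemma inj_on_scale_matrix:
  fixes M :: "nat \<Rightarrow> 'a::field ^ 'n::finite"
  assumes M: "M \<in> shared_at E m s"
  shows "inj_on (\<lambda>g. scale_matrix m s g M) nonzero_scalings"
proof (rule inj_onI)
  fix g h :: "('n \<Rightarrow> 'a) \<times> 'a"
  assume g: "g \<in> nonzero_scalings" and h: "h \<in> nonzero_scalings"
    and eq: "scale_matrix m s g M = scale_matrix m s h M"
  have entry: "fst g v * (if r = s then snd g else 1) = fst h v * (if r = s then snd h else 1)"
    if "r < m" "M r $ v \<noteq> 0" for r v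
    using arg_cong[OF eq, of "\<lambda>N. N r $ v"] that by (simp add: scale_matrix_def)
  obtain v0 r0 where v0: "s < m" "M s $ v0 \<noteq> 0" "r0 < m" "r0 \<noteq> s" "M r0 $ v0 \<noteq> 0"
    using M by (auto simp: shared_at_def shared_row_def)
  have "fst g v0 = fst h v0"
    using entry[OF v0(3,5)] v0(4) by simp
  moreover have "fst g v0 \<noteq> 0"
    using g by (auto simp: nonzero_scalings_def)
  ultimately have snd: "snd g = snd h"
    using entry[OF v0(1,2)] by simp
  moreover have "snd g \<noteq> 0"
    using g by (auto simp: nonzero_scalings_def)
  ultimately have "fst g v = fst h v" for v
  proof -
    obtain r where "r < m" "M r $ v \<noteq> 0"
      using clique_matrices_column_nonzero[of M E m v] M by (auto simp: shared_at_def)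
    then show ?thesis
      using entry[of r v] snd \<open>snd g \<noteq> 0\<close> by (simp split: if_splits)
  qed
  then show "g = h"
    using snd by (intro prod_eqI ext) auto
qed

lemma finite_clique_matrices:
  "finite (clique_matrices E m :: (nat \<Rightarrow> 'a::{field,finite} ^ 'n::finite) set)"
  by (rule finite_subset[of _ "{..<m} \<rightarrow>\<^sub>E UNIV"]) (auto simp: clique_matrices_def intro!: finite_PiE)

lemma dvd_card_shared_at:
  "(CARD('a) - 1) ^ (CARD('n) + 1)
     dvd card (shared_at E m s :: (nat \<Rightarrow> 'a::{field,finite} ^ 'n::finite) set)"
proof -
  let ?X = "shared_at E m s :: (nat \<Rightarrow> 'a ^ 'n) set"
  let ?U = "nonzero_scalings :: (('n \<Rightarrow> 'a) \<times> 'a) set"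
  have ext: "M \<in> {..<m} \<rightarrow>\<^sub>E UNIV" if "M \<in> ?X" for M
    using that by (simp add: shared_at_def clique_matrices_def)
  have "card ?U dvd card ?X"
  proof (rule card_dvd_card_if_free_action)
    show "finite ?X"
      using finite_clique_matrices by (rule rev_finite_subset) (auto simp: shared_at_def)
    show "scale_matrix m s g M \<in> ?X" if "g \<in> ?U" "M \<in> ?X" for g M
    proof -
      have "shared_row m (scale_matrix m s g M) r = shared_row m M r" for r
        using scale_matrix_eq_0_iff[OF that(1)] by (simp add: shared_row_def cong: conj_cong)
      then show ?thesis
        using that scale_matrix_mem_clique_matrices[OF that(1)] by (simp add: shared_at_def)
    qed
    show "(\<lambda>_. 1, 1) \<in> ?U"
      by (simp add: nonzero_scalings_def)
    show "scale_matrix m s (\<lambda>_. 1, 1) M = M" if "M \<in> ?X" for M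
      using ext[OF that] by (auto simp: scale_matrix_def fun_eq_iff vec_eq_iff PiE_def extensional_def)
    show "\<exists>k\<in>?U. \<forall>M\<in>?X. scale_matrix m s g (scale_matrix m s h M) = scale_matrix m s k M"
      if "g \<in> ?U" "h \<in> ?U" for g h
    proof (intro bexI ballI)
      show "(\<lambda>v. fst g v * fst h v, snd g * snd h) \<in> ?U"
        using that by (auto simp: nonzero_scalings_def)
    qed (auto simp: scale_matrix_def fun_eq_iff vec_eq_iff)
    show "\<exists>h\<in>?U. \<forall>M\<in>?X. scale_matrix m s h (scale_matrix m s g M) = M" if g: "g \<in> ?U" for g
    proof (intro bexI ballI)
      show "(\<lambda>v. inverse (fst g v), inverse (snd g)) \<in> ?U"
        using g by (auto simp: nonzero_scalings_def)
    next
      fix M assume "M \<in> ?X"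
      moreover have "inverse (fst g v) * fst g v = 1" "inverse (snd g) * snd g = 1"
        "inverse (fst g v) * (inverse (snd g) * (fst g v * snd g)) = 1" for v
        using g by (auto simp: nonzero_scalings_def field_simps)
      ultimately show
        "scale_matrix m s (\<lambda>v. inverse (fst g v), inverse (snd g)) (scale_matrix m s g M) = M"
        using ext by (auto simp: scale_matrix_def fun_eq_iff vec_eq_iff PiE_def extensional_def)
    qed
    show "inj_on (\<lambda>g. scale_matrix m s g M) ?U" if "M \<in> ?X" for M
      using that by (rule inj_on_scale_matrix)
  qed
  then show ?thesis
    by (simp only: card_nonzero_scalings)
qed

section \<open>Monomial matrices and proper colourings\<close>

definition monomial_matrix ::
    "nat \<Rightarrow> ('n \<Rightarrow> nat) \<Rightarrow> ('n \<Rightarrow> 'a) \<Rightarrow> (nat \<Rightarrow> 'a::field ^ 'n::finite)" where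
  "monomial_matrix m c u = (\<lambda>r\<in>{..<m}. \<chi> v. if r = c v then u v else 0)"

lemma monomial_matrix_mem_clique_matrices:
  fixes u :: "'n::finite \<Rightarrow> 'a::field"
  assumes c: "c \<in> proper_colorings E m" and u: "\<And>v. u v \<noteq> 0"
  shows "monomial_matrix m c u \<in> clique_matrices E m"
proof -
  have "\<exists>r<m. (\<Sum>i\<in>C. a i * monomial_matrix m c u r $ i) \<noteq> 0"
    if C: "clique C E" and j: "j \<in> C" "a j \<noteq> 0" for C j and a :: "'n \<Rightarrow> 'a"
  proof (intro exI conjI)
    show cj: "c j < m"
      using c by (auto simp: proper_colorings_def)
    (* Colours are distinct on a clique, so the row of the colour of j sees only the vertex j. *)
    have "(\<Sum>i\<in>C. a i * monomial_matrix m c u (c j) $ i) = (\<Sum>i\<in>C. if i = j then a i * u i else 0)"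
      using C j c cj
      by (intro sum.cong) (auto simp: monomial_matrix_def proper_colorings_def clique_def)
    then show "(\<Sum>i\<in>C. a i * monomial_matrix m c u (c j) $ i) \<noteq> 0"
      using j u by simp
  qed
  moreover have "monomial_matrix m c u \<in> {..<m} \<rightarrow>\<^sub>E UNIV"
    by (simp add: monomial_matrix_def)
  ultimately show ?thesis
    unfolding clique_matrices_def by blast
qed

lemma proper_coloring_if_monomial_matrix:
  assumes E: "simple_graph E" and c: "\<And>v. c v < m" and u: "\<And>v. u v \<noteq> 0"
    and M: "monomial_matrix m c u \<in> clique_matrices E m"
  shows "c \<in> proper_colorings E m"
proof -
  have "c x \<noteq> c y" if xy: "{x, y} \<in> E" for x y
  proof
    assume eq: "c x = c y"
    have "card {x, y} = 2"
      using xy E by (auto simp: simple_graph_def nsets_def)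
    then have ne: "x \<noteq> y"
      by auto
    have "clique {x, y} E"
      using xy by (auto simp: clique_def insert_commute)
    (* Both columns are multiples of the same unit vector; these coefficients cancel them. *)
    moreover define a where "a = (\<lambda>v. if v = x then inverse (u x) else - inverse (u y))"
    moreover have "\<exists>i\<in>{x, y}. a i \<noteq> 0"
      using u by (auto simp: a_def)
    ultimately obtain r where "r < m" "(\<Sum>i\<in>{x, y}. a i * monomial_matrix m c u r $ i) \<noteq> 0"
      using clique_matricesE[OF M, of "{x, y}" a] by blast
    then show False
      using ne eq u by (auto simp: monomial_matrix_def a_def split: if_splits)
  qed
  then show ?thesis
    using c by (simp add: proper_colorings_def)
qed

lemma monomial_matrix_if_not_shared:
  assumes M: "M \<in> clique_matrices E m" and not_shared: "\<And>s. \<not> shared_row m M s"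
  obtains c u where "M = monomial_matrix m c u" "\<And>v. c v < m" "\<And>v. u v \<noteq> 0"
proof -
  obtain c where c: "\<And>v. c v < m \<and> M (c v) $ v \<noteq> 0"
    using clique_matrices_column_nonzero[OF M] by metis
  have zero: "M r $ v = 0" if "r < m" "r \<noteq> c v" for r v
    using not_shared[of r] c[of v] that by (auto simp: shared_row_def)
  have "M = monomial_matrix m c (\<lambda>v. M (c v) $ v)"
  proof
    fix r
    show "M r = monomial_matrix m c (\<lambda>v. M (c v) $ v) r"
      using M zero
      by (cases "r < m")
        (auto simp: monomial_matrix_def clique_matrices_def vec_eq_iff PiE_def extensional_def)
  qed
  then show ?thesis
    using c that[of c "\<lambda>v. M (c v) $ v"] by blast
qed

lemma card_monomial_matrices:
  fixes E :: "'n::finite set set"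
  assumes E: "simple_graph E"
  shows "card {M \<in> (clique_matrices E m :: (nat \<Rightarrow> 'a::{field,finite} ^ 'n) set).
                 \<forall>s. \<not> shared_row m M s}
         = card (proper_colorings E m) * (CARD('a) - 1) ^ CARD('n)"
proof -
  let ?U = "{u :: 'n \<Rightarrow> 'a. \<forall>v. u v \<noteq> 0}"
  let ?f = "\<lambda>(c, u). monomial_matrix m c u :: nat \<Rightarrow> 'a ^ 'n"
  let ?X = "{M \<in> (clique_matrices E m :: (nat \<Rightarrow> 'a ^ 'n) set). \<forall>s. \<not> shared_row m M s}"
  have entry: "monomial_matrix m c u r $ v = (if r = c v then u v else 0)" if "r < m"
    for c r v and u :: "'n \<Rightarrow> 'a"
    using that by (simp add: monomial_matrix_def)
  have "bij_betw ?f (proper_colorings E m \<times> ?U) ?X"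
  proof (rule bij_betw_imageI)
    show "inj_on ?f (proper_colorings E m \<times> ?U)"
    proof (rule inj_onI, clarify)
      fix c d and u w :: "'n \<Rightarrow> 'a"
      assume c: "c \<in> proper_colorings E m" and "d \<in> proper_colorings E m"
        and u: "\<forall>v. u v \<noteq> 0" and "\<forall>v. w v \<noteq> 0"
        and eq: "monomial_matrix m c u = (monomial_matrix m d w :: nat \<Rightarrow> 'a ^ 'n)"
      have "c v = d v \<and> u v = w v" for v
      proof -
        have "c v < m"
          using c by (auto simp: proper_colorings_def)
        then show ?thesis
          using arg_cong[OF eq, of "\<lambda>N. N (c v) $ v"] u by (simp add: entry split: if_splits)
      qed
      then show "c = d \<and> u = w"
        by auto
    qed
    show "?f ` (proper_colorings E m \<times> ?U) = ?X"
    proof (intro subset_antisym subsetI)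
      fix M assume "M \<in> ?f ` (proper_colorings E m \<times> ?U)"
      then obtain c u where cu: "c \<in> proper_colorings E m" "\<forall>v. u v \<noteq> 0" "M = monomial_matrix m c u"
        by auto
      then show "M \<in> ?X"
        using monomial_matrix_mem_clique_matrices[of c E m u]
        by (auto simp: shared_row_def entry split: if_splits)
    next
      fix M assume M: "M \<in> ?X"
      then obtain c u where "M = monomial_matrix m c u" "\<And>v. c v < m" "\<And>v. u v \<noteq> 0"
        using monomial_matrix_if_not_shared[of M E m] by blast
      then show "M \<in> ?f ` (proper_colorings E m \<times> ?U)"
        using proper_coloring_if_monomial_matrix[OF E, of c m u] M by auto
    qed
  qed
  then have "card ?X = card (proper_colorings E m \<times> ?U)"
    by (simp add: bij_betw_same_card)
  then show ?thesis
    by (simp add: card_cartesian_product card_nonzero_functions)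
qed

lemma card_clique_matrices:
  fixes E :: "'n::finite set set"
  assumes E: "simple_graph E"
  shows "\<exists>k. card (clique_matrices E m :: (nat \<Rightarrow> 'a::{field,finite} ^ 'n) set)
           = (CARD('a) - 1) ^ CARD('n) * (card (proper_colorings E m) + (CARD('a) - 1) * k)"
proof -
  let ?K = "clique_matrices E m :: (nat \<Rightarrow> 'a ^ 'n) set"
  let ?S = "shared_at E m :: nat \<Rightarrow> (nat \<Rightarrow> 'a ^ 'n) set"
  let ?X = "{M \<in> ?K. \<forall>s. \<not> shared_row m M s}"
  have fin: "finite (?S s)" for s
    using finite_clique_matrices by (rule rev_finite_subset) (auto simp: shared_at_def)
  have "?K = ?X \<union> (\<Union>s\<in>{..<m}. ?S s)"
  proof (intro subset_antisym subsetI)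
    fix M assume M: "M \<in> ?K"
    show "M \<in> ?X \<union> (\<Union>s\<in>{..<m}. ?S s)"
    proof (cases "\<exists>s. shared_row m M s")
      case True
      define s where "s = (LEAST s. shared_row m M s)"
      have "shared_row m M s" "\<forall>r<s. \<not> shared_row m M r"
        unfolding s_def using True by (auto intro: LeastI_ex dest: not_less_Least)
      then show ?thesis
        using M by (auto simp: shared_at_def shared_row_def)
    qed (use M in auto)
  qed (auto simp: shared_at_def)
  moreover have "?X \<inter> (\<Union>s\<in>{..<m}. ?S s) = {}"
    by (auto simp: shared_at_def)
  moreover have "finite ?X"
    using finite_clique_matrices by (rule rev_finite_subset) auto
  moreover have "finite (\<Union>s\<in>{..<m}. ?S s)"
    using fin by simp
  ultimately have "card ?K = card ?X + card (\<Union>s\<in>{..<m}. ?S s)"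
    by (metis (no_types, lifting) card_Un_disjoint)
  also have "card (\<Union>s\<in>{..<m}. ?S s) = (\<Sum>s<m. card (?S s))"
  proof (rule card_UN_disjoint)
    show "\<forall>s\<in>{..<m}. \<forall>t\<in>{..<m}. s \<noteq> t \<longrightarrow> ?S s \<inter> ?S t = {}"
      unfolding shared_at_def by (blast elim: linorder_neqE_nat)
  qed (use fin in auto)
  finally have card: "card ?K = card ?X + (\<Sum>s<m. card (?S s))" .
  have "(CARD('a) - 1) ^ (CARD('n) + 1) dvd (\<Sum>s<m. card (?S s))"
    by (intro dvd_sum dvd_card_shared_at)
  then obtain k where "(\<Sum>s<m. card (?S s)) = (CARD('a) - 1) ^ (CARD('n) + 1) * k"
    by blast
  then show ?thesis
    unfolding card card_monomial_matrices[OF E] by (intro exI[of _ k]) (simp add: algebra_simps)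
qed

section \<open>Few colours determine the chromatic polynomial\<close>

definition onto_colorings :: "'n set set \<Rightarrow> nat set \<Rightarrow> ('n \<Rightarrow> nat) set" where
  "onto_colorings E S = {c. range c = S \<and> (\<forall>u v. {u, v} \<in> E \<longrightarrow> c u \<noteq> c v)}"

lemma card_onto_colorings:
  assumes "finite S"
  shows "card (onto_colorings E S) = card (onto_colorings E {..<card S})"
proof -
  obtain h where h: "bij_betw h S {..<card S}"
    using assms ex_bij_betw_finite_nat[OF assms] by (auto simp: lessThan_atLeast0)
  let ?g = "inv_into S h"
  have g: "bij_betw ?g {..<card S} S"
    using h by (rule bij_betw_inv_into)
  have move: "f \<circ> c \<in> onto_colorings E T" if "bij_betw f R T" "c \<in> onto_colorings E R" for f R T c
  proof -
    have "f ` range c = T"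
      using that by (simp add: onto_colorings_def bij_betw_def)
    moreover have "f (c u) \<noteq> f (c v)" if "c u \<noteq> c v" for u v
      using \<open>bij_betw f R T\<close> \<open>c \<in> onto_colorings E R\<close> that
      by (auto simp: onto_colorings_def bij_betw_def inj_on_def)
    ultimately show ?thesis
      using that by (auto simp: onto_colorings_def image_comp)
  qed
  have "bij_betw (\<lambda>c. h \<circ> c) (onto_colorings E S) (onto_colorings E {..<card S})"
  proof (rule bij_betwI[where g = "\<lambda>c. ?g \<circ> c"])
    show "?g \<circ> (h \<circ> c) = c" if "c \<in> onto_colorings E S" for c
      using that h by (auto simp: onto_colorings_def fun_eq_iff bij_betw_inv_into_left)
    show "h \<circ> (?g \<circ> c) = c" if "c \<in> onto_colorings E {..<card S}" for c
    proof
      fix v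
      have "c v \<in> {..<card S}"
        using that by (auto simp: onto_colorings_def)
      then show "(h \<circ> (?g \<circ> c)) v = c v"
        using bij_betw_inv_into_right[OF h] by simp
    qed
  qed (use move[OF h] move[OF g] in auto)
  then show ?thesis
    by (rule bij_betw_same_card)
qed

lemma proper_colorings_subset: "proper_colorings E k \<subseteq> UNIV \<rightarrow>\<^sub>E {..<k}"
  by (auto simp: proper_colorings_def)

lemma card_proper_colorings_sum:
  fixes E :: "'n::finite set set"
  shows "card (proper_colorings E k) = (\<Sum>S\<in>Pow {..<k}. card (onto_colorings E {..<card S}))"
proof -
  have "finite (UNIV \<rightarrow>\<^sub>E {..<k} :: ('n \<Rightarrow> nat) set)"
    by (auto intro!: finite_PiE)
  then have "finite (proper_colorings E k)"
    using proper_colorings_subset by (rule rev_finite_subset)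
  moreover have Un: "proper_colorings E k = (\<Union>S\<in>Pow {..<k}. onto_colorings E S)"
    by (auto simp: proper_colorings_def onto_colorings_def)
  ultimately have "card (proper_colorings E k) = (\<Sum>S\<in>Pow {..<k}. card (onto_colorings E S))"
    unfolding Un by (intro card_UN_disjoint) (auto simp: onto_colorings_def)
  also have "\<dots> = (\<Sum>S\<in>Pow {..<k}. card (onto_colorings E {..<card S}))"
    by (intro sum.cong refl card_onto_colorings) (auto intro: finite_subset)
  finally show ?thesis .
qed

text \<open>
  The sum over the sets of colours actually used is triangular with respect to their cardinality,
  so the counts for at most \<open>\<ell>\<close> colours determine the numbers of colourings onto a given set of at
  most \<open>\<ell>\<close> colours; onto a larger set there are none.
\<close>

lemma card_proper_colorings_determined:
  fixes G H :: "'n::finite set set"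
  assumes few: "\<And>k. k \<le> CARD('n) \<Longrightarrow> card (proper_colorings G k) = card (proper_colorings H k)"
  shows "card (proper_colorings G k) = card (proper_colorings H k)"
proof -
  have "card (onto_colorings G {..<j}) = card (onto_colorings H {..<j})" for j
  proof (induction j rule: less_induct)
    case (less j)
    show ?case
    proof (cases "j \<le> CARD('n)")
      case True
      have top: "card (proper_colorings E j) = card (onto_colorings E {..<j})
                  + (\<Sum>S\<in>Pow {..<j} - {{..<j}}. card (onto_colorings E {..<card S}))"
        for E :: "'n set set"
        unfolding card_proper_colorings_sum by (subst sum.remove[of _ "{..<j}"]) auto
      have "card S < j" if "S \<in> Pow {..<j} - {{..<j}}" for S
        using that psubset_card_mono[of "{..<j}" S] by auto
      then have "(\<Sum>S\<in>Pow {..<j} - {{..<j}}. card (onto_colorings G {..<card S}))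
               = (\<Sum>S\<in>Pow {..<j} - {{..<j}}. card (onto_colorings H {..<card S}))"
        by (intro sum.cong less.IH refl)
      then show ?thesis
        using few[OF True] top by simp
    next
      case False
      have "range c \<noteq> {..<j}" for c :: "'n \<Rightarrow> nat"
        using False card_image_le[of UNIV c] by auto
      then have "onto_colorings E {..<j} = {}" for E :: "'n set set"
        by (simp add: onto_colorings_def)
      then show ?thesis
        by simp
    qed
  qed
  then show ?thesis
    by (simp add: card_proper_colorings_sum)
qed

lemma card_proper_colorings_le:
  fixes E :: "'n::finite set set"
  shows "card (proper_colorings E k) \<le> k ^ CARD('n)"
proof -
  have "card (proper_colorings E k) \<le> card (UNIV \<rightarrow>\<^sub>E {..<k} :: ('n \<Rightarrow> nat) set)"
    by (intro card_mono proper_colorings_subset) (auto intro!: finite_PiE)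
  then show ?thesis
    by (simp add: card_PiE)
qed

lemma card_proper_colorings_pos:
  fixes E :: "'n::finite set set"
  assumes E: "simple_graph E"
  shows "0 < card (proper_colorings E CARD('n))"
proof -
  obtain h where h: "bij_betw h (UNIV :: 'n set) {..<CARD('n)}"
    using ex_bij_betw_finite_nat[of "UNIV :: 'n set"] by (auto simp: lessThan_atLeast0)
  have "h u \<noteq> h v" if "{u, v} \<in> E" for u v
  proof -
    have "card {u, v} = 2"
      using that E by (auto simp: simple_graph_def nsets_def)
    then have "u \<noteq> v"
      by auto
    then show ?thesis
      using h by (auto simp: bij_betw_def inj_on_def)
  qed
  then have "h \<in> proper_colorings E CARD('n)"
    using h by (auto simp: proper_colorings_def bij_betw_def)
  moreover have "finite (proper_colorings E CARD('n))"
    by (rule finite_subset[OF proper_colorings_subset]) (auto intro!: finite_PiE)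
  ultimately show ?thesis
    by (auto simp: card_gt_0_iff)
qed

section \<open>Recovering the chromatic polynomial\<close>

theorem corollary2p6:
  fixes G H :: "'n::finite set set"
  assumes "simple_graph G" and "simple_graph H"
    and "CARD('a::{field,finite}) > CARD('n) ^ CARD('n)"
    and "arrangement_char_poly (q_graphical_arrangement G :: ('a ^ 'n) set set) =
         arrangement_char_poly (q_graphical_arrangement H :: ('a ^ 'n) set set)"
  shows "chromatic_poly G = chromatic_poly H"
proof -
  let ?q = "CARD('a)" and ?l = "CARD('n)"
  let ?N = "\<lambda>E k. card (proper_colorings (E :: 'n set set) k)"
  have l: "?l ^ ?l \<le> ?q - 1" "0 < ?q - 1"
  proof -
    have "0 < ?l ^ ?l"
      by simp
    then show "?l ^ ?l \<le> ?q - 1" "0 < ?q - 1"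
      using assms(3) by linarith+
  qed
  have few: "?N G k = ?N H k" if k: "k \<le> ?l" for k
  proof -
    have "card (clique_matrices G k :: (nat \<Rightarrow> 'a ^ 'n) set)
        = card (clique_matrices H k :: (nat \<Rightarrow> 'a ^ 'n) set)"
      using poly_char_poly_q_graphical_arrangement[where 'a = 'a, of G k]
        poly_char_poly_q_graphical_arrangement[where 'a = 'a, of H k] assms(4) by simp
    then obtain a b where "(?q - 1) ^ ?l * (?N G k + (?q - 1) * a)
                         = (?q - 1) ^ ?l * (?N H k + (?q - 1) * b)"
      using card_clique_matrices[OF assms(1), where 'a = 'a]
        card_clique_matrices[OF assms(2), where 'a = 'a] by metis
    then have "?N G k + (?q - 1) * a = ?N H k + (?q - 1) * b"
      using l by simp
    then have "int (?N G k) + int (?q - 1) * int a = int (?N H k) + int (?q - 1) * int b"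
      by (simp only: flip: of_nat_add of_nat_mult)
    then have "int (?N G k) - int (?N H k) = int (?q - 1) * (int b - int a)"
      unfolding right_diff_distrib by linarith
    then have dvd: "int (?q - 1) dvd int (?N G k) - int (?N H k)"
      by simp
    (* The bound has to be strict also for q - 1 = l ^ l: with fewer than l colours the counts are
       below l ^ l, and with l colours they are positive. *)
    have "\<bar>int (?N G k) - int (?N H k)\<bar> < int (?l ^ ?l)"
    proof (cases "k = ?l")
      case True
      then have "0 < ?N G k" "0 < ?N H k" "?N G k \<le> ?l ^ ?l" "?N H k \<le> ?l ^ ?l"
        using card_proper_colorings_pos assms(1,2) card_proper_colorings_le by auto
      then show ?thesis
        by linarith
    next
      case False
      then have "k ^ ?l < ?l ^ ?l"
        using k by (intro power_strict_mono) auto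
      then have "?N G k < ?l ^ ?l" "?N H k < ?l ^ ?l"
        using card_proper_colorings_le le_less_trans by blast+
      then show ?thesis
        by linarith
    qed
    then have "\<bar>int (?N G k) - int (?N H k)\<bar> < int (?q - 1)"
      using l(1) by linarith
    then show ?thesis
      using dvd zdvd_not_zless[of "\<bar>int (?N G k) - int (?N H k)\<bar>" "int (?q - 1)"] by auto
  qed
  show ?thesis
    unfolding chromatic_poly_def using card_proper_colorings_determined[OF few] by simp
qed

end
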